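(* Let $c\colon Z_3^3\times Z_3^3\to Z_3$ be the function given by the explicit $27\times 27$ matrix $M$ displayed in the context. Then $c$ satisfies, for all $x,y,x_1,x_2,x_3\in Z_3^3$, (i) $c(x,x)=0$; (ii) $c(x*y,y)=c(x,y)$; (iii) $c(x_1*x_3,x_2*x_3)-c(x_1*x_2,x_3)=-c(x_1,x_2)+c(x_2,x_3)+c(x_1,x_3)$; (iv) $c(x,y)=c(y,x)$. Moreover, let $(Z_3\times Z_3^3,\hat{*})$ be the set $Z_3\times Z_3^3$ with the operation $$(a_1,x_1)\,\hat{*}\,(a_2,x_2)=(a_1*a_2+c(x_1,x_2),\;x_1*x_2).$$ Then $(Z_3\times Z_3^3,\hat{*})$ satisfies the kei axioms and the relation $a=b*a*b$ for all elements $a,b$ (equivalently, it is a commutative kei); it has $81$ elements; it is generated by the four elements $(1,0,0,0)$, $(0,1,0,0)$, $(0,0,1,0)$, $(0,0,0,1)$ (so, for example, it cannot be isomorphic to $\mathrm{Core}(Z_3^4)$, which has five generators as a kei); and the kei $\bar Q(4,3)$ is isomorphic to $(Z_3\times Z_3^3,\hat{*})$.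
   Context: A kei (also called an involutory quandle) is a set $Q$ with a binary operation $*$ such that for all $a,b,c\in Q$: $a*a=a$; $(a*b)*b=a$; $(a*b)*c=(a*c)*(b*c)$. Products without parentheses are left-normed, so $b*a*b$ means $(b*a)*b$. A kei is commutative if $a*b=b*a$ for all elements $a,b$. $\bar Q(4,3)$ denotes the universal Burnside kei on $4$ generators with the universal relation $a=b*a*b$; this relation is equivalent to commutativity, so $\bar Q(4,3)$ is the free commutative kei on $4$ generators. $Z_3$ is the integers modulo $3$ with the dihedral kei operation $i*j=2j-i=-j-i \pmod 3$, and $Z_3^3$ carries this operation coordinatewise; $+$ and $-$ denote addition and subtraction in $Z_3$. An element of $Z_3\times Z_3^3$ is written as a $4$-tuple whose first entry is the $Z_3$ factor. $\mathrm{Core}(Z_3^4)$ is the group $Z_3^4$ with the operation $a*b=2b-a$. The elements of $Z_3^3$ are numbered $1$ to $27$ in lexicographic order: 1.(0,0,0); 2.(0,0,1); 3.(0,0,2); 4.(0,1,0); ...; 27.(2,2,2); that is, $(p,q,r)$ with $p,q,r\in\{0,1,2\}$ has number $9p+3q+r+1$. The value of $c$ on the elements numbered $i$ and $j$ (in this order) is the entry $m_{ij}$ of the matrix $M$. The rows of $M$ are as follows (each row lists its $27$ one-digit entries $m_{i1},\dots,m_{i27}$ in order, with spaces after the 9th and 18th entries only for readability): Row 1: 011012021 012012012 021021021 Row 2: 101012210 201120012 102210021 Row 3: 110120210 201012120 021210102 Row 4: 001000010 201120012 021102210 Row 5: 112000211 012120201 102021210 Row 6: 220000220 120120120 210210210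 Row 7: 022022000 012120201 102021210 Row 8: 211112000 120120120 021021021 Row 9: 100010000 201120012 210021102 Row 10: 022201012 000120102 022021210 Row 11: 100012120 000012210 001021210 Row 12: 211120201 000201021 121021210 Row 13: 010111111 102000120 111111001 Row 14: 121222222 210000012 222222121 Row 15: 202000000 021000201 000000022 Row 16: 001021210 120102000 012010201 Row 17: 112102021 012210000 201211120 Row 18: 220210102 201021000 120220012 Row 19: 010012102 001120021 000210201 Row 20: 202201021 202120102 000021120 Row 21: 121120210 211120210 000102012 Row 22: 022102000 000120022 201000210 Row 23: 211021222 222120112 120000021 Row 24: 100210111 111120010 012000102 Row 25: 001222201 222010210 210201000 Row 26: 220111120 111022021 021120000 Row 27: 112000012 000112102 102012000 *)

theory Defs
  imports "HOL-Library.Numeral_Type" "HOL-Library.Product_Plus"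
begin

section \<open>Kei\<close>

text \<open>All kei considered here have a full type as their underlying set.\<close>

locale kei =
  fixes op :: "'a \<Rightarrow> 'a \<Rightarrow> 'a"  (infixl \<open>\<star>\<close> 70)
  assumes idem: "a \<star> a = a"
    and invol: "(a \<star> b) \<star> b = a"
    and distrib: "(a \<star> b) \<star> c = (a \<star> c) \<star> (b \<star> c)"

locale commutative_kei = kei +
  assumes comm: "a \<star> b = b \<star> a"

text \<open>Right translations of a kei are their own inverses, so a subset closed under the
  operation is a subkei.\<close>

inductive_set kei_span :: "('a \<Rightarrow> 'a \<Rightarrow> 'a) \<Rightarrow> 'a set \<Rightarrow> 'a set"
  for op :: "'a \<Rightarrow> 'a \<Rightarrow> 'a" and S :: "'a set" where
  base: "x \<in> S \<Longrightarrow> x \<in> kei_span op S"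
| step: "x \<in> kei_span op S \<Longrightarrow> y \<in> kei_span op S \<Longrightarrow> op x y \<in> kei_span op S"

definition generates :: "('a \<Rightarrow> 'a \<Rightarrow> 'a) \<Rightarrow> 'a set \<Rightarrow> bool" where
  "generates op S \<longleftrightarrow> kei_span op S = UNIV"

definition min_generator_number :: "('a \<Rightarrow> 'a \<Rightarrow> 'a) \<Rightarrow> nat \<Rightarrow> bool" where
  "min_generator_number op n \<longleftrightarrow>
     (\<exists>S. finite S \<and> card S = n \<and> generates op S) \<and>
     (\<forall>S. finite S \<and> generates op S \<longrightarrow> n \<le> card S)"

definition kei_isomorphic :: "('a \<Rightarrow> 'a \<Rightarrow> 'a) \<Rightarrow> ('b \<Rightarrow> 'b \<Rightarrow> 'b) \<Rightarrow> bool" where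
  "kei_isomorphic op op' \<longleftrightarrow> (\<exists>f. bij f \<and> (\<forall>x y. f (op x y) = op' (f x) (f y)))"

section \<open>Universal Burnside kei with relation $a = b * a * b$\<close>

datatype 'g kei_term = Gen 'g | Prod "'g kei_term" "'g kei_term"

text \<open>The least congruence on terms over the generators that contains all instances of the kei
  axioms and of the relation; the latter is imposed on all elements, not only on generators.\<close>

inductive burnside3_cong :: "'g kei_term \<Rightarrow> 'g kei_term \<Rightarrow> bool" where
  refl: "burnside3_cong a a"
| sym: "burnside3_cong a b \<Longrightarrow> burnside3_cong b a"
| trans: "burnside3_cong a b \<Longrightarrow> burnside3_cong b c \<Longrightarrow> burnside3_cong a c"
| cong: "burnside3_cong a a' \<Longrightarrow> burnside3_cong b b' \<Longrightarrow> burnside3_cong (Prod a b) (Prod a' b')"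
| idem: "burnside3_cong (Prod a a) a"
| invol: "burnside3_cong (Prod (Prod a b) b) a"
| distrib: "burnside3_cong (Prod (Prod a b) c) (Prod (Prod a c) (Prod b c))"
| burnside: "burnside3_cong a (Prod (Prod b a) b)"

quotient_type 'g burnside3 = "'g kei_term" / burnside3_cong
  by (rule equivpI)
    (auto intro!: reflpI sympI transpI intro: burnside3_cong.refl burnside3_cong.sym burnside3_cong.trans)

text \<open>\<open>burnside3_op :: 4 burnside3 \<Rightarrow> _\<close> is the operation of $\bar Q(4,3)$, the
  four-element type \<open>4\<close> being the set of generators.\<close>

lift_definition burnside3_op :: "'g burnside3 \<Rightarrow> 'g burnside3 \<Rightarrow> 'g burnside3" is Prod
  by (rule burnside3_cong.cong)

section \<open>Core of an abelian group\<close>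

text \<open>$a * b = 2b - a$. On type \<open>3\<close> (the integers modulo 3) this is the dihedral kei $Z_3$; on
  tuples, whose group operations are componentwise, it acts coordinatewise.\<close>

definition core_op :: "'a::ab_group_add \<Rightarrow> 'a \<Rightarrow> 'a" where
  "core_op a b = b + b - a"

lemma core_op_3: "core_op (i::3) j = 2 * j - i" "core_op (i::3) j = - j - i"
proof -
  show 1: "core_op i j = 2 * j - i"
    by (simp add: core_op_def)
  have "(2::3) = - 1" by simp
  then have "2 * j = - j" by (simp only: mult_minus1)
  then show "core_op i j = - j - i" by (simp only: 1)
qed

lemma core_op_Pair: "core_op (a, x) (b, y) = (core_op a b, core_op x y)"
  by (simp add: core_op_def)

section \<open>The function \<open>c\<close> and the extension\<close>

type_synonym Z3_cube = "3 \<times> 3 \<times> 3"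

definition Z3_nat :: "3 \<Rightarrow> nat" where
  "Z3_nat i = (if i = 0 then 0 else if i = 1 then 1 else 2)"

fun number :: "Z3_cube \<Rightarrow> nat" where
  "number (p, q, r) = 9 * Z3_nat p + 3 * Z3_nat q + Z3_nat r + 1"

definition M :: "nat list list" where
  "M = [
    [0,1,1,0,1,2,0,2,1, 0,1,2,0,1,2,0,1,2, 0,2,1,0,2,1,0,2,1],
    [1,0,1,0,1,2,2,1,0, 2,0,1,1,2,0,0,1,2, 1,0,2,2,1,0,0,2,1],
    [1,1,0,1,2,0,2,1,0, 2,0,1,0,1,2,1,2,0, 0,2,1,2,1,0,1,0,2],
    [0,0,1,0,0,0,0,1,0, 2,0,1,1,2,0,0,1,2, 0,2,1,1,0,2,2,1,0],
    [1,1,2,0,0,0,2,1,1, 0,1,2,1,2,0,2,0,1, 1,0,2,0,2,1,2,1,0],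
    [2,2,0,0,0,0,2,2,0, 1,2,0,1,2,0,1,2,0, 2,1,0,2,1,0,2,1,0],
    [0,2,2,0,2,2,0,0,0, 0,1,2,1,2,0,2,0,1, 1,0,2,0,2,1,2,1,0],
    [2,1,1,1,1,2,0,0,0, 1,2,0,1,2,0,1,2,0, 0,2,1,0,2,1,0,2,1],
    [1,0,0,0,1,0,0,0,0, 2,0,1,1,2,0,0,1,2, 2,1,0,0,2,1,1,0,2],
    [0,2,2,2,0,1,0,1,2, 0,0,0,1,2,0,1,0,2, 0,2,2,0,2,1,2,1,0],
    [1,0,0,0,1,2,1,2,0, 0,0,0,0,1,2,2,1,0, 0,0,1,0,2,1,2,1,0],
    [2,1,1,1,2,0,2,0,1, 0,0,0,2,0,1,0,2,1, 1,2,1,0,2,1,2,1,0],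
    [0,1,0,1,1,1,1,1,1, 1,0,2,0,0,0,1,2,0, 1,1,1,1,1,1,0,0,1],
    [1,2,1,2,2,2,2,2,2, 2,1,0,0,0,0,0,1,2, 2,2,2,2,2,2,1,2,1],
    [2,0,2,0,0,0,0,0,0, 0,2,1,0,0,0,2,0,1, 0,0,0,0,0,0,0,2,2],
    [0,0,1,0,2,1,2,1,0, 1,2,0,1,0,2,0,0,0, 0,1,2,0,1,0,2,0,1],
    [1,1,2,1,0,2,0,2,1, 0,1,2,2,1,0,0,0,0, 2,0,1,2,1,1,1,2,0],
    [2,2,0,2,1,0,1,0,2, 2,0,1,0,2,1,0,0,0, 1,2,0,2,2,0,0,1,2],
    [0,1,0,0,1,2,1,0,2, 0,0,1,1,2,0,0,2,1, 0,0,0,2,1,0,2,0,1],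
    [2,0,2,2,0,1,0,2,1, 2,0,2,1,2,0,1,0,2, 0,0,0,0,2,1,1,2,0],
    [1,2,1,1,2,0,2,1,0, 2,1,1,1,2,0,2,1,0, 0,0,0,1,0,2,0,1,2],
    [0,2,2,1,0,2,0,0,0, 0,0,0,1,2,0,0,2,2, 2,0,1,0,0,0,2,1,0],
    [2,1,1,0,2,1,2,2,2, 2,2,2,1,2,0,1,1,2, 1,2,0,0,0,0,0,2,1],
    [1,0,0,2,1,0,1,1,1, 1,1,1,1,2,0,0,1,0, 0,1,2,0,0,0,1,0,2],
    [0,0,1,2,2,2,2,0,1, 2,2,2,0,1,0,2,1,0, 2,1,0,2,0,1,0,0,0],
    [2,2,0,1,1,1,1,2,0, 1,1,1,0,2,2,0,2,1, 0,2,1,1,2,0,0,0,0],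
    [1,1,2,0,0,0,0,1,2, 0,0,0,1,1,2,1,0,2, 1,0,2,0,1,2,0,0,0]
  ]"

text \<open>Elements are numbered from 1, list positions from 0.\<close>

definition c :: "Z3_cube \<Rightarrow> Z3_cube \<Rightarrow> 3" where
  "c x y = of_nat (M ! (number x - 1) ! (number y - 1))"

fun ext_op :: "3 \<times> Z3_cube \<Rightarrow> 3 \<times> Z3_cube \<Rightarrow> 3 \<times> Z3_cube" where
  "ext_op (a1, x1) (a2, x2) = (core_op a1 a2 + c x1 x2, core_op x1 x2)"

end

theory Submission
  imports Defs
begin

text \<open>Two facts carry the theorem.

\<^emph>\<open>The extension.\<close> On $Z_3^3$ the function $(p-p')(qr'-rq')$ of two points $(p,q,r)$ and
$(p',q',r')$ is a symmetric kei cocycle; this is a polynomial identity in characteristic 3. The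
function \<open>c\<close> differs from it only by the coboundary of a function of one point (\<open>c_eq\<close>), and
coboundaries satisfy the cocycle identities for formal reasons. So only \<open>c_eq\<close> has to be compared
with the table. The identities for \<open>c\<close> are what the kei axioms and commutativity of the extension
amount to. The four points of the extension generate it: they project onto an affine basis of
$Z_3^3$, and the three products such as $(ab)(ed)$, $(ae)(bd)$ and $(ad)(be)$ fill up the fibre
over the point (1,1,1), after which every other fibre is reached by one more product.

\<^emph>\<open>The bound.\<close> A commutative kei generated by four elements $e,a,b,d$ has at most 81 elements. If it
were medial it would be an affine space over $Z_3$ of dimension at most 3. The failure of mediality
is measured by the three products $u_1=(ab)(ed)$, $u_2=(ae)(bd)$, $u_3=(ad)(be)$. They satisfy
$u_1u_2=u_3$ (\<open>opposite_mids_collinear\<close>), so that the composite \<open>shift\<close> of the reflections in two of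
them is independent of the choice up to inversion, has order dividing 3, and is inverted under
conjugation by every reflection (\<open>shift_mult\<close>): it is a central translation. Modulo its orbits the
translations along $ea$, $eb$, $ed$ commute, because their commutators move the fourth generator
only by a shift (\<open>near_translations_commute\<close>). Hence every element is a shift of one of the 27
products of powers of these translations applied to $e$, and there are at most $3 \cdot 27$ elements.

The free commutative kei on four generators maps onto the extension, which has 81 elements, so the
bound makes this map bijective. The comparison with the core of $Z_3^4$ is linear algebra: $n$ points
span an affine subspace with at most $3^{n-1}$ points.\<close>

section \<open>Left-normed words and opposite edges of a tetrahedron\<close>

context kei begin

text \<open>The right translation by a product is a conjugate of a right translation, hence a composite of the
  translations by the factors.\<close>

lemma act_product: "x \<star> (y \<star> z) = ((x \<star> z) \<star> y) \<star> z"
  by (metis distrib invol)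

lemma hom_agree:
  assumes "kei_span (\<star>) S = UNIV"
    and "\<And>x y. f (x \<star> y) = f x \<star> f y" "\<And>x y. g (x \<star> y) = g x \<star> g y"
    and "\<And>s. s \<in> S \<Longrightarrow> f s = g s"
  shows "f x = g x"
proof -
  have "x \<in> kei_span (\<star>) S" using assms(1) by simp
  then show ?thesis
    by induction (simp_all add: assms)
qed

text \<open>Since translations by products are composites of translations by factors, left-normed words in the
  generators already exhaust the span.\<close>

lemma span_subset_if_closed_under_generators:
  assumes "S \<subseteq> K" and closed: "\<And>x s. x \<in> K \<Longrightarrow> s \<in> S \<Longrightarrow> x \<star> s \<in> K"
  shows "kei_span (\<star>) S \<subseteq> K"
proof
  have act: "\<forall>x \<in> K. x \<star> y \<in> K" if "y \<in> kei_span (\<star>) S" for y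
    using that by induction (auto simp: closed act_product)
  fix x assume "x \<in> kei_span (\<star>) S"
  then show "x \<in> K"
    by induction (use assms(1) act in auto)
qed

end

context commutative_kei begin

lemma distrib_left: "x \<star> (y \<star> z) = (x \<star> y) \<star> (x \<star> z)"
  by (metis distrib comm)

lemma cancel [simp]:
  "(x \<star> y) \<star> y = x" "(y \<star> x) \<star> y = x" "y \<star> (x \<star> y) = x" "y \<star> (y \<star> x) = x"
  by (metis invol comm)+

text \<open>The right translations by two elements are involutions with this relation and so generate a quotient
  of the dihedral group of order 6.\<close>

lemma braid: "((x \<star> y) \<star> z) \<star> y = ((x \<star> z) \<star> y) \<star> z"
  by (metis act_product comm)

text \<open>In an affine space over $Z_3$ the product of two points is the third point of their line, and this
  product is $p+q+r+s$, whichever way the tetrahedron $pqrs$ is split into two opposite edges. In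
  general the three splittings give three different points.\<close>

definition opposite_mid :: "'a \<Rightarrow> 'a \<Rightarrow> 'a \<Rightarrow> 'a \<Rightarrow> 'a" where
  "opposite_mid p q r s = (p \<star> q) \<star> (r \<star> s)"

lemma opposite_mid_swap:
  "opposite_mid p q r s = opposite_mid q p r s"
  "opposite_mid p q r s = opposite_mid p q s r"
  "opposite_mid p q r s = opposite_mid r s p q"
  by (simp_all add: opposite_mid_def comm)

lemma vertex_opposite_mid: "p \<star> opposite_mid p q r s = q \<star> (p \<star> (r \<star> s))"
  unfolding opposite_mid_def by (metis distrib cancel(3) comm)

text \<open>Both factors on the left have the form \<open>a \<star> _\<close>, so distributivity reduces the claim to an identity
  among $b,e,d$, where everything takes place in an affine plane.\<close>

lemma opposite_mid_edge:
  "(b \<star> opposite_mid a b e d) \<star> (d \<star> opposite_mid a d b e) = a \<star> e"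
proof -
  have "(b \<star> (e \<star> d)) \<star> (d \<star> (b \<star> e)) = e"
  proof -
    have "e \<star> (d \<star> (b \<star> e)) = (e \<star> d) \<star> b"
      by (metis distrib_left cancel(3))
    then show ?thesis
      by (metis cancel(3) comm)
  qed
  moreover have "b \<star> opposite_mid a b e d = a \<star> (b \<star> (e \<star> d))"
    using vertex_opposite_mid[of b a e d] by (simp add: opposite_mid_swap(1)[of b a])
  moreover have "d \<star> opposite_mid a d b e = a \<star> (d \<star> (b \<star> e))"
    using vertex_opposite_mid[of d a b e] by (simp add: opposite_mid_swap(1)[of d a])
  ultimately show ?thesis
    by (simp add: distrib_left[symmetric])
qed

text \<open>The three points attached to the pairs of opposite edges of a tetrahedron form a line. The proof
  obtains $u_2(du_3)=u_1(du_2)$ by writing $ae$ in the two ways that the preceding identity offers, and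
  then multiplies by $du_2$.\<close>

lemma opposite_mids_collinear:
  "opposite_mid a b e d \<star> opposite_mid a e b d = opposite_mid a d b e"
proof -
  define u1 u2 u3 where u: "u1 = opposite_mid a b e d" "u2 = opposite_mid a e b d" "u3 = opposite_mid a d b e"
  have ae: "(b \<star> u1) \<star> (d \<star> u3) = a \<star> e" "(b \<star> u3) \<star> (d \<star> u1) = a \<star> e"
    using opposite_mid_edge[of b a e d] opposite_mid_edge[of b e a d]
    unfolding u by (simp_all add: opposite_mid_swap comm)
  have u2: "u2 = (a \<star> e) \<star> (b \<star> d)" by (simp add: u opposite_mid_def)
  have "u2 \<star> (d \<star> u3) = (b \<star> u1) \<star> ((b \<star> d) \<star> (d \<star> u3))"
    unfolding u2 by (metis ae(1) distrib cancel(1))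
  also have "\<dots> = (b \<star> u1) \<star> (d \<star> (b \<star> u3))"
    by (metis distrib_left comm)
  also have "\<dots> = u1 \<star> (d \<star> u2)"
  proof -
    have "d \<star> u2 = ((d \<star> (b \<star> u3)) \<star> u1) \<star> b"
      unfolding u2 by (metis ae(2) distrib_left cancel(3,4) comm)
    then show ?thesis
      by (metis distrib_left cancel comm)
  qed
  finally have eq: "u2 \<star> (d \<star> u3) = u1 \<star> (d \<star> u2)" .
  have "u1 = (u2 \<star> (d \<star> u3)) \<star> (d \<star> u2)"
    by (simp add: eq)
  also have "\<dots> = (u2 \<star> (d \<star> u2)) \<star> ((d \<star> u3) \<star> (d \<star> u2))"
    by (rule distrib)
  also have "\<dots> = d \<star> (d \<star> (u3 \<star> u2))"
    by (simp add: distrib_left[symmetric])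
  finally show ?thesis
    unfolding u[symmetric] by simp
qed

lemma dihedral_cube: "(((((x \<star> p) \<star> q) \<star> p) \<star> q) \<star> p) \<star> q = x"
  by (simp add: braid)

text \<open>The composite of two point reflections is the translation by twice their difference. For the
  standard generators of the extension the three points \<open>opposite_mid\<close> form a fibre over $Z_3^3$,
  so there this is the translation by a constant along the fibres.\<close>

definition shift :: "'a \<Rightarrow> 'a \<Rightarrow> 'a \<Rightarrow> 'a \<Rightarrow> 'a \<Rightarrow> 'a" where
  "shift e a b d x = (x \<star> opposite_mid a e b d) \<star> opposite_mid a b e d"

lemma shift_cube: "shift e a b d (shift e a b d (shift e a b d x)) = x"
  by (simp add: shift_def dihedral_cube)

lemma shift_hom: "shift e a b d (x \<star> y) = shift e a b d x \<star> shift e a b d y"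
  unfolding shift_def distrib[of x y] by (rule distrib)

text \<open>As $u_1u_2=u_3$, the reflections in the three points satisfy
  $R_{u_1}R_{u_2}=R_{u_2}R_{u_3}=R_{u_3}R_{u_1}$; the rotation of $a,b,d$ permutes the $u_i$ cyclically.\<close>

lemma shift_rotate: "shift e a b d = shift e b d a"
proof
  fix x
  define u1 u2 u3 where u: "u1 = opposite_mid a b e d" "u2 = opposite_mid a e b d" "u3 = opposite_mid a d b e"
  have "u3 = u1 \<star> u2" "u3 = u2 \<star> u1"
    using opposite_mids_collinear[of a b e d] by (simp_all add: u comm)
  then have "(x \<star> u2) \<star> u1 = (x \<star> u3) \<star> u2"
    by (metis act_product invol)
  moreover have "u3 = opposite_mid b e d a" "u2 = opposite_mid b d e a"
    by (simp_all add: u opposite_mid_def comm)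
  ultimately show "shift e a b d x = shift e b d a x"
    by (simp add: shift_def u(1,2)[symmetric])
qed

text \<open>A double transposition of the four points fixes all three points \<open>opposite_mid\<close>.\<close>

lemma shift_double_swap: "shift e a b d = shift a e d b"
  by (simp add: fun_eq_iff shift_def opposite_mid_def comm)

text \<open>This lemma and the next are what is needed to see that conjugation by the reflection in $e$
  inverts the shift: automorphisms have to be compared on the four generators only. Here \<open>e \<star> e\<close> is
  kept to make the two statements uniform.\<close>

lemma reflection_shift_self: "e \<star> shift e a b d (e \<star> e) = shift e a b d (shift e a b d e)"
proof -
  define u1 u2 where u: "u1 = opposite_mid a b e d" "u2 = opposite_mid a e b d"
  have "e \<star> ((e \<star> u2) \<star> u1) = (e \<star> u1) \<star> u2"
    by (metis distrib_left cancel(4) comm)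
  then have "shift e a b d (e \<star> shift e a b d e) = e"
    by (simp add: shift_def u[symmetric])
  then have "shift e a b d (shift e a b d (shift e a b d (e \<star> shift e a b d e))) = shift e a b d (shift e a b d e)"
    by simp
  then show ?thesis
    by (simp only: shift_cube idem)
qed

lemma reflection_shift_other: "e \<star> shift e a b d (e \<star> a) = shift e a b d (shift e a b d a)"
proof -
  define u1 u2 u3 where u: "u1 = opposite_mid a b e d" "u2 = opposite_mid a e b d" "u3 = opposite_mid a d b e"
  have bd: "b \<star> d = (e \<star> u1) \<star> (a \<star> u3)"
    using opposite_mid_edge[of e d b a] by (simp add: u opposite_mid_def comm)
  have "(e \<star> a) \<star> u2 = b \<star> d"
    by (simp add: u opposite_mid_def comm)
  then have "e \<star> (((e \<star> a) \<star> u2) \<star> u1) = e \<star> (((e \<star> u1) \<star> (a \<star> u3)) \<star> u1)"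
    by (simp add: bd)
  also have "\<dots> = (e \<star> ((e \<star> u1) \<star> u1)) \<star> (e \<star> ((a \<star> u3) \<star> u1))"
    by (metis distrib distrib_left)
  also have "\<dots> = (a \<star> u3) \<star> u1"
    by (simp add: idem)
  also have "\<dots> = (a \<star> u1) \<star> (u3 \<star> u1)"
    by (rule distrib)
  also have "u3 \<star> u1 = u2"
    using opposite_mids_collinear[of a b e d] by (simp add: u[symmetric]) (metis cancel(2))
  finally have "shift e a b d (e \<star> shift e a b d (e \<star> a)) = a"
    by (simp add: shift_def u[symmetric])
  then have "shift e a b d (shift e a b d (shift e a b d (e \<star> shift e a b d (e \<star> a))))
      = shift e a b d (shift e a b d a)"
    by simp
  then show ?thesis
    by (simp only: shift_cube)
qed

text \<open>In an affine space this is the translation that carries $e$ to $p$.\<close>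

definition translation :: "'a \<Rightarrow> 'a \<Rightarrow> 'a \<Rightarrow> 'a" where
  "translation e p x = e \<star> (x \<star> p)"

lemma translation_cube: "translation e p (translation e p (translation e p x)) = x"
  using dihedral_cube[of x p e] by (simp add: translation_def comm[of e])

lemma translation_hom: "translation e p (x \<star> y) = translation e p x \<star> translation e p y"
  unfolding translation_def distrib[of x y] by (rule distrib_left)

lemma translation_reflection: "translation e p x \<star> e = translation e p (translation e p (x \<star> e))"
proof -
  have "e \<star> ((x \<star> e) \<star> p) = x \<star> (e \<star> p)"
    by (simp add: distrib_left[of e "x \<star> e" p])
  moreover have "(x \<star> (e \<star> p)) \<star> p = (x \<star> p) \<star> e"
    by (simp add: distrib[of x "e \<star> p" p])
  ultimately show ?thesis by (simp add: translation_def)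
qed

end

section \<open>Commutative kei with four generators\<close>

locale four_generated = commutative_kei +
  fixes e a b d
  assumes gen: "kei_span (\<star>) {e, a, b, d} = UNIV"
begin

abbreviation \<sigma> where "\<sigma> \<equiv> shift e a b d"

text \<open>Both sides are automorphisms in \<open>x\<close>. The rotations of $a,b,d$ leave the shift unchanged and so
  reduce the generators $b$ and $d$ to $a$.\<close>

lemma reflection_shift_origin: "e \<star> \<sigma> (e \<star> x) = \<sigma> (\<sigma> x)"
proof (rule hom_agree[OF gen, where f = "\<lambda>x. e \<star> \<sigma> (e \<star> x)" and g = "\<lambda>x. \<sigma> (\<sigma> x)"])
  show "e \<star> \<sigma> (e \<star> (x \<star> y)) = (e \<star> \<sigma> (e \<star> x)) \<star> (e \<star> \<sigma> (e \<star> y))" for x y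
    by (simp add: distrib_left[of e] shift_hom)
  show "\<sigma> (\<sigma> (x \<star> y)) = \<sigma> (\<sigma> x) \<star> \<sigma> (\<sigma> y)" for x y
    by (simp add: shift_hom)
  have 1: "\<sigma> = shift e b d a" by (rule shift_rotate)
  also have 2: "\<dots> = shift e d a b" by (rule shift_rotate)
  finally have 3: "\<sigma> = shift e d a b" .
  show "e \<star> \<sigma> (e \<star> s) = \<sigma> (\<sigma> s)" if "s \<in> {e, a, b, d}" for s
    using that reflection_shift_self[of e a b d] reflection_shift_other[of e a b d]
      reflection_shift_other[of e b d a, folded 1] reflection_shift_other[of e d a b, folded 3]
    by blast
qed

text \<open>The double transpositions carry $e$ to every other generator without changing the shift.\<close>

lemma reflection_shift_generator:
  assumes "s \<in> {e, a, b, d}"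
  shows "s \<star> \<sigma> (s \<star> x) = \<sigma> (\<sigma> x)"
proof -
  have A: "\<sigma> = shift a e d b" by (rule shift_double_swap)
  have B: "\<sigma> = shift b d e a"
    by (metis shift_rotate shift_double_swap)
  have D: "\<sigma> = shift d b a e"
    by (metis shift_rotate shift_double_swap)
  interpret A: four_generated "(\<star>)" a e d b
  proof
    have "{a, e, d, b} = {e, a, b, d}" by auto
    then show "kei_span (\<star>) {a, e, d, b} = UNIV" by (simp only: gen)
  qed
  interpret B: four_generated "(\<star>)" b d e a
  proof
    have "{b, d, e, a} = {e, a, b, d}" by auto
    then show "kei_span (\<star>) {b, d, e, a} = UNIV" by (simp only: gen)
  qed
  interpret D: four_generated "(\<star>)" d b a e
  proof
    have "{d, b, a, e} = {e, a, b, d}" by auto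
    then show "kei_span (\<star>) {d, b, a, e} = UNIV" by (simp only: gen)
  qed
  show ?thesis
    using assms reflection_shift_origin A.reflection_shift_origin[folded A]
      B.reflection_shift_origin[folded B] D.reflection_shift_origin[folded D]
    by blast
qed

text \<open>Centrality of the shift. Since a shift is inverted by the reflections in the generators, it is
  inverted by every composite of an odd number of them, and by \<open>act_product\<close> every translation of the
  kei is such a composite. The inverse is written as the square.\<close>

lemma shift_mult: "\<sigma> x \<star> y = \<sigma> (\<sigma> (x \<star> y))"
proof -
  have "y \<in> kei_span (\<star>) {e, a, b, d}" by (simp add: gen)
  then have "\<forall>x. \<sigma> x \<star> y = \<sigma> (\<sigma> (x \<star> y))"
  proof induction
    case (base s)
    show ?case
    proof
      fix x
      have "s \<star> \<sigma> (s \<star> (s \<star> x)) = \<sigma> (\<sigma> (s \<star> x))"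
        by (rule reflection_shift_generator[OF base])
      then show "\<sigma> x \<star> s = \<sigma> (\<sigma> (x \<star> s))" by (simp add: comm)
    qed
  next
    case (step y z)
    have "\<sigma> (\<sigma> x) \<star> z = \<sigma> (x \<star> z)" for x
      using step.IH(2) by (simp add: shift_cube)
    then show ?case
      using step.IH by (simp add: act_product shift_cube)
  qed
  then show ?thesis by blast
qed

lemma shift_funpow_mult: "(\<sigma> ^^ n) x \<star> y = (\<sigma> ^^ (2 * n)) (x \<star> y)"
  by (induction n) (simp_all add: shift_mult)

lemma shift_funpow_3: "(\<sigma> ^^ (3 * n)) x = x"
  by (induction n) (simp_all add: shift_cube numeral_3_eq_3)

text \<open>The orbit relation of the shift. It is a congruence, and modulo it the kei behaves like an
  affine space; working with the relation avoids forming the quotient.\<close>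

definition near :: "'a \<Rightarrow> 'a \<Rightarrow> bool" where
  "near x y \<longleftrightarrow> (\<exists>n. y = (\<sigma> ^^ n) x)"

lemma near_refl [simp]: "near x x"
  unfolding near_def by (metis funpow_0)

lemma near_trans [trans]: "near x y \<Longrightarrow> near y z \<Longrightarrow> near x z"
  unfolding near_def by (metis comp_apply funpow_add)

lemma near_sym: "near x y \<Longrightarrow> near y x"
  unfolding near_def
proof (elim exE)
  fix n assume "y = (\<sigma> ^^ n) x"
  then have "(\<sigma> ^^ (2 * n)) y = (\<sigma> ^^ (2 * n + n)) x"
    by (simp only: funpow_add comp_apply)
  also have "\<dots> = x" using shift_funpow_3[of n x] by simp
  finally show "\<exists>n. x = (\<sigma> ^^ n) y" by metis
qed

lemma near_mult_right: "near x x' \<Longrightarrow> near (x \<star> y) (x' \<star> y)"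
  unfolding near_def by (metis shift_funpow_mult)

lemma near_mult: "near x x' \<Longrightarrow> near y y' \<Longrightarrow> near (x \<star> y) (x' \<star> y')"
  by (metis near_mult_right near_trans comm)

lemma near_translation: "near x y \<Longrightarrow> near (translation e p x) (translation e p y)"
  by (simp add: translation_def near_mult)

lemma near_translation_funpow:
  "near x y \<Longrightarrow> near ((translation e p ^^ n) x) ((translation e p ^^ n) y)"
  by (induction n) (simp_all add: near_translation)

text \<open>Both composites respect products, so the points where they agree up to a shift form a subkei. On
  $e,a,b$ they agree exactly, as these points lie in an affine plane; on $d$ their values are two of
  the three collinear points \<open>opposite_mid\<close>, which differ by a shift.\<close>

lemma near_translations_commute:
  "near (translation e a (translation e b x)) (translation e b (translation e a x))"
proof -
  have "x \<in> kei_span (\<star>) {e, a, b, d}" by (simp add: gen)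
  then show ?thesis
  proof induction
    case (base s)
    have e: "translation e a (translation e b e) = translation e b (translation e a e)"
      by (simp add: translation_def idem comm)
    have a: "translation e a (translation e b a) = translation e b (translation e a a)"
      by (simp add: translation_def idem distrib[of e "a \<star> b" a])
    have b: "translation e a (translation e b b) = translation e b (translation e a b)"
      by (simp add: translation_def idem distrib[of e "b \<star> a" b])
    have mid: "translation e p (translation e q d) = opposite_mid p e q d" for p q
    proof -
      have "d \<star> q = (p \<star> e) \<star> opposite_mid p e q d"
        by (simp add: opposite_mid_def comm)
      then have "e \<star> (d \<star> q) = p \<star> (e \<star> opposite_mid p e q d)"
        by (simp add: distrib_left[of e "p \<star> e"])
      then show ?thesis
        by (simp add: translation_def)
    qed
    have "\<sigma> (opposite_mid a e b d) = opposite_mid a d b e"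
      unfolding shift_def idem comm[of "opposite_mid a e b d"] by (rule opposite_mids_collinear)
    moreover have "opposite_mid a d b e = opposite_mid b e a d"
      by (simp add: opposite_mid_def comm)
    ultimately have "(\<sigma> ^^ 1) (opposite_mid a e b d) = opposite_mid b e a d"
      by simp
    then have d: "near (opposite_mid a e b d) (opposite_mid b e a d)"
      unfolding near_def by metis
    show ?case
      using base d by (auto simp: e a b mid)
  next
    case (step x y)
    then show ?case
      by (simp add: translation_hom near_mult)
  qed
qed

lemma rotated: "four_generated (\<star>) e b d a"
proof
  have "{e, b, d, a} = {e, a, b, d}" by auto
  then show "kei_span (\<star>) {e, b, d, a} = UNIV" by (simp only: gen)
qed

lemma near_rotated: "four_generated.near (\<star>) e b d a = near"
  by (simp add: fun_eq_iff near_def four_generated.near_def[OF rotated] shift_rotate[of e a b d])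

end

text \<open>The commutation of two maps up to a preorder passes to powers.\<close>

lemma funpow_commute_upto:
  assumes "\<And>x y. R x y \<Longrightarrow> R (f x) (f y)" "\<And>x. R (g (f x)) (f (g x))"
    and "\<And>x. R x x" "\<And>x y z. R x y \<Longrightarrow> R y z \<Longrightarrow> R x z"
  shows "R (g ((f ^^ n) x)) ((f ^^ n) (g x))"
proof (induction n)
  case (Suc n)
  have "R (g (f ((f ^^ n) x))) (f (g ((f ^^ n) x)))" by (rule assms(2))
  moreover have "R (f (g ((f ^^ n) x))) (f ((f ^^ n) (g x)))" by (rule assms(1)[OF Suc])
  ultimately have "R (g (f ((f ^^ n) x))) (f ((f ^^ n) (g x)))" by (rule assms(4))
  then show ?case by simp
qed (simp add: assms)

context four_generated begin

definition normal_form :: "nat \<Rightarrow> nat \<Rightarrow> nat \<Rightarrow> 'a" where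
  "normal_form i j k = (translation e a ^^ i) ((translation e b ^^ j) ((translation e d ^^ k) e))"

text \<open>The points near a normal form are closed under the three translations by the commutation up to
  shifts, and under the reflection in $e$, which inverts the translations and fixes $e$. The reflection
  in another generator $p$ is the translation along $ep$ followed by the reflection in $e$.\<close>

lemma near_normal_form: "\<exists>i j k. near (normal_form i j k) x"
proof -
  let ?K = "{x. \<exists>i j k. near (normal_form i j k) x}"
  let ?A = "translation e a" and ?B = "translation e b" and ?D = "translation e d"
  interpret r: four_generated "(\<star>)" e b d a by (rule rotated)
  interpret rr: four_generated "(\<star>)" e d a b by (rule r.rotated)
  have nr: "r.near = near" "rr.near = near"
    using near_rotated r.near_rotated by simp_all
  have BA: "near (?B ((?A ^^ n) x)) ((?A ^^ n) (?B x))" for n x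
    by (rule funpow_commute_upto[where R = near])
      (fact near_translation near_refl near_trans near_sym[OF near_translations_commute])+
  have DA: "near (?D ((?A ^^ n) x)) ((?A ^^ n) (?D x))" for n x
    by (rule funpow_commute_upto[where R = near])
      (fact near_translation near_refl near_trans rr.near_translations_commute[unfolded nr])+
  have DB: "near (?D ((?B ^^ n) x)) ((?B ^^ n) (?D x))" for n x
    by (rule funpow_commute_upto[where R = near])
      (fact near_translation near_refl near_trans near_sym[OF r.near_translations_commute[unfolded nr]])+
  have KA: "?A x \<in> ?K" if "x \<in> ?K" for x
  proof -
    from that obtain i j k where "near (normal_form i j k) x" by blast
    then have "near (normal_form (Suc i) j k) (?A x)"
      by (simp add: normal_form_def near_translation)
    then show ?thesis by blast
  qed
  have KB: "?B x \<in> ?K" if "x \<in> ?K" for x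
  proof -
    from that obtain i j k where "near (normal_form i j k) x" by blast
    then have "near (?B (normal_form i j k)) (?B x)"
      by (rule near_translation)
    moreover have "near (?B (normal_form i j k)) (normal_form i (Suc j) k)"
      by (simp add: normal_form_def BA)
    ultimately show ?thesis using near_sym near_trans by blast
  qed
  have KD: "?D x \<in> ?K" if "x \<in> ?K" for x
  proof -
    from that obtain i j k where "near (normal_form i j k) x" by blast
    then have "near (?D (normal_form i j k)) (?D x)"
      by (rule near_translation)
    moreover have "near (?D (normal_form i j k)) (normal_form i j (Suc k))"
      unfolding normal_form_def funpow.simps comp_apply
      by (rule near_trans[OF DA near_translation_funpow[OF DB]])
    ultimately show ?thesis using near_sym near_trans by blast
  qed
  \<comment> \<open>Conjugation by the reflection in e inverts a translation; exponents are doubled since inverses are squares.\<close>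
  have KE: "x \<star> e \<in> ?K" if "x \<in> ?K" for x
  proof -
    have E: "(translation e p ^^ n) x \<star> e = (translation e p ^^ (2 * n)) (x \<star> e)" for p n x
      by (induction n) (simp_all add: translation_reflection)
    from that obtain i j k where "near (normal_form i j k) x" by blast
    then have "near (normal_form i j k \<star> e) (x \<star> e)"
      by (rule near_mult_right)
    then have "near (normal_form (2 * i) (2 * j) (2 * k)) (x \<star> e)"
      by (simp add: normal_form_def E idem)
    then show ?thesis by blast
  qed
  have mult: "x \<star> s \<in> ?K" if "x \<in> ?K" "s \<in> {e, a, b, d}" for x s
  proof -
    have t: "translation e p x \<star> e = x \<star> p" for p
      by (simp add: translation_def)
    show ?thesis
      using that(2) KE[OF that(1)] KE[OF KA[OF that(1)]] KE[OF KB[OF that(1)]] KE[OF KD[OF that(1)]]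
      unfolding t by (elim insertE) (simp_all only: empty_iff)
  qed
  have "{e, a, b, d} \<subseteq> ?K"
  proof -
    have e: "e \<in> ?K"
    proof -
      have "near (normal_form 0 0 0) e" by (simp add: normal_form_def)
      then show ?thesis by blast
    qed
    have "translation e p e = p" for p by (simp add: translation_def)
    then show ?thesis using e KA[OF e] KB[OF e] KD[OF e] by simp
  qed
  then have "kei_span (\<star>) {e, a, b, d} \<subseteq> ?K"
    using mult by (rule span_subset_if_closed_under_generators)
  then show ?thesis using gen by blast
qed

lemma card_le_81: "finite (UNIV :: 'a set)" "card (UNIV :: 'a set) \<le> 81"
proof -
  let ?I = "{..<3::nat} \<times> {..<3::nat} \<times> {..<3::nat} \<times> {..<3::nat}"
  let ?f = "\<lambda>(l, i, j, k). (\<sigma> ^^ l) (normal_form i j k)"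
  have red: "(f ^^ (n mod 3)) x = (f ^^ n) x" if "\<And>x. f (f (f x)) = x" for f :: "'a \<Rightarrow> 'a" and n x
    by (rule funpow_mod_eq) (simp add: that numeral_3_eq_3)
  have "x \<in> ?f ` ?I" for x
  proof -
    obtain i j k l where "x = (\<sigma> ^^ l) (normal_form i j k)"
      using near_normal_form near_def by blast
    also have "\<dots> = (\<sigma> ^^ (l mod 3)) (normal_form (i mod 3) (j mod 3) (k mod 3))"
      by (simp add: normal_form_def red shift_cube translation_cube)
    finally have "x = ?f (l mod 3, i mod 3, j mod 3, k mod 3)" by simp
    then show ?thesis by (rule image_eqI) simp
  qed
  then have U: "UNIV = ?f ` ?I" by blast
  show "finite (UNIV :: 'a set)" unfolding U by simp
  have "card ?I = 81" by (simp add: card_cartesian_product)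
  then show "card (UNIV :: 'a set) \<le> 81"
    unfolding U using card_image_le[of ?I ?f] by simp
qed

end

section \<open>The function c as a cocycle\<close>

lemma all_Z3: "(\<forall>x::3. P x) \<longleftrightarrow> P 0 \<and> P 1 \<and> P 2"
proof -
  have "{0, 1, 2 :: 3} = UNIV"
    by (rule card_subset_eq) simp_all
  then have "(\<forall>x::3. P x) \<longleftrightarrow> (\<forall>x \<in> {0, 1, 2 :: 3}. P x)" by simp
  then show ?thesis by simp
qed

lemma triple_Z3: "x + x + x = (0::3)"
  using all_Z3[of "\<lambda>x. x + x + x = 0"] by simp

text \<open>A solution, determined up to an affine function, of the linear system over $Z_3$ which says that
  \<open>c - det_cocycle\<close> is the coboundary of this function. The list follows the numbering of the points.\<close>

definition potential :: "Z3_cube \<Rightarrow> 3" where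
  "potential x = of_nat ([1,1,2,0,1,2,2,2,2, 2,1,0,2,0,1,0,0,0, 0,1,2,2,1,0,0,0,0] ! (number x - 1))"

text \<open>Up to coboundaries this does not depend on which coordinate is singled out: in the extension it
  defines, the failure of mediality on four points is, up to sign, the determinant of their differences.\<close>

fun det_cocycle :: "Z3_cube \<Rightarrow> Z3_cube \<Rightarrow> 3" where
  "det_cocycle (p, q, r) (p', q', r') = (p - p') * (q * r' - r * q')"

text \<open>The coboundary of a function $g$ is $g(x)+g(y)+g(x*y)$ because \<open>core_op\<close> on $Z_3$ is $-a-b$. The proof
  goes through the 729 entries of the table; the identities of \<open>c\<close> need no further case distinction.\<close>

lemma c_eq: "c x y = det_cocycle x y + (potential x + potential y + potential (core_op x y))"
proof -
  have "\<forall>p q r p' q' r'. c (p, q, r) (p', q', r') =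
    det_cocycle (p, q, r) (p', q', r') + (potential (p, q, r) + potential (p', q', r') + potential (core_op (p, q, r) (p', q', r')))"
    unfolding all_Z3
    by (intro conjI; simp add: c_def potential_def M_def Z3_nat_def core_op_Pair core_op_3(2))
  then show ?thesis by (cases x; cases y) auto
qed

lemma core_op_Z3_cube: "core_op (p, q, r) (p', q', r') = (- p' - p :: 3, - q' - q :: 3, - r' - r :: 3)"
  by (simp add: core_op_Pair core_op_3(2))

lemma core_op_exponent_3:
  fixes x y :: "'a::ab_group_add"
  assumes "\<And>z::'a. z + z + z = 0"
  shows "core_op x y = - x - y"
proof -
  have "y + y = - y"
    using assms[of y] by (simp only: eq_neg_iff_add_eq_0)
  then show ?thesis by (simp add: core_op_def)
qed

lemma three_eq_zero: "3 * x = (0::3)"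
  using triple_Z3[of x] by simp

lemma triple_Z3_prod: "(\<And>x. x + x + x = (0 :: 'a::ab_group_add)) \<Longrightarrow> z + z + z = (0 :: 3 \<times> 'a)"
  by (cases z) (simp add: triple_Z3 three_eq_zero zero_prod_def)

lemma triple_Z3_cube: "x + x + x = (0 :: Z3_cube)"
  by (intro triple_Z3_prod triple_Z3)

lemma triple_Z3_4: "x + x + x = (0 :: 3 \<times> 3 \<times> 3 \<times> 3)"
  by (intro triple_Z3_prod triple_Z3)

lemma det_cocycle_diag: "det_cocycle x x = 0"
  by (cases x) simp

lemma det_cocycle_sym: "det_cocycle x y = det_cocycle y x"
  by (cases x; cases y) (simp add: algebra_simps)

text \<open>The identities of the determinantal cocycle hold over every commutative ring up to a multiple of 3.
  They are proved there because numerals of type \<open>3\<close> are reduced modulo 3 in the course of ring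
  normalization.\<close>

lemma det_core_identity:
  fixes p :: "'a::comm_ring_1"
  shows "(- p' - p - p') * ((- q' - q) * r' - (- r' - r) * q') - (p - p') * (q * r' - r * q')
    = 3 * (p' * (q * r' - r * q'))"
  by (simp add: algebra_simps)

lemma det_cocycle_identity:
  fixes p :: "'a::comm_ring_1"
  shows "(- s - p - (- s - p')) * ((- t - q) * (- u - r') - (- u - r) * (- t - q'))
    - (- p' - p - s) * ((- q' - q) * u - (- r' - r) * t)
    - (- ((p - p') * (q * r' - r * q')) + (p' - s) * (q' * u - r' * t) + (p - s) * (q * u - r * t))
    = - 3 * (p * (q * u - r * t) + p' * (q' * u - r' * t))"
  by (simp add: algebra_simps)

lemma det_cocycle_core: "det_cocycle (core_op x y) y = det_cocycle x y"
proof -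
  obtain p q r p' q' r' where xy: "x = (p, q, r)" "y = (p', q', r')" by (metis prod_cases3)
  have "det_cocycle (core_op x y) y - det_cocycle x y = 3 * (p' * (q * r' - r * q'))"
    unfolding xy core_op_Z3_cube det_cocycle.simps by (rule det_core_identity)
  then show ?thesis by (simp add: three_eq_zero)
qed

lemma det_cocycle_cocycle:
  "det_cocycle (core_op x z) (core_op y z) - det_cocycle (core_op x y) z
    = - det_cocycle x y + det_cocycle y z + det_cocycle x z"
proof -
  obtain p q r p' q' r' s t u where xyz: "x = (p, q, r)" "y = (p', q', r')" "z = (s, t, u)"
    by (metis prod_cases3)
  have "det_cocycle (core_op x z) (core_op y z) - det_cocycle (core_op x y) z
    - (- det_cocycle x y + det_cocycle y z + det_cocycle x z)
    = - 3 * (p * (q * u - r * t) + p' * (q' * u - r' * t))"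
    unfolding xyz core_op_Z3_cube det_cocycle.simps by (rule det_cocycle_identity)
  then show ?thesis by (simp add: three_eq_zero)
qed

lemma core_op_self: "core_op x x = x"
  by (simp add: core_op_def)

lemma c_diag: "c x x = 0"
  using triple_Z3[of "potential x"] by (simp only: c_eq det_cocycle_diag core_op_self add_0_left)

lemma c_sym: "c x y = c y x"
proof -
  have "core_op x y = core_op y x"
    by (simp add: core_op_exponent_3 triple_Z3_cube)
  then show ?thesis
    by (simp add: c_eq det_cocycle_sym[of x y])
qed

lemma core_op_core_op: "core_op (core_op x y) y = x"
  by (simp add: core_op_def)

lemma c_core_op: "c (core_op x y) y = c x y"
  by (simp add: c_eq det_cocycle_core core_op_core_op)

text \<open>For the coboundary part, the terms of the identity cancel in pairs by distributivity, except for
  three times the potential of \<open>x3\<close>.\<close>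

lemma c_cocycle:
  "c (core_op x1 x3) (core_op x2 x3) - c (core_op x1 x2) x3 = - c x1 x2 + c x2 x3 + c x1 x3"
proof -
  have "core_op (core_op x1 x3) (core_op x2 x3) = core_op (core_op x1 x2) x3"
    by (simp add: core_op_def algebra_simps)
  moreover have "potential x3 = - potential x3 - potential x3"
    using triple_Z3[of "potential x3"] by (simp only: eq_diff_eq eq_neg_iff_add_eq_0)
  ultimately show ?thesis
    using det_cocycle_cocycle[of x1 x3 x2] by (simp add: c_eq algebra_simps)
qed

section \<open>The extension\<close>

lemma commutative_kei_ext_op: "commutative_kei ext_op"
proof
  fix u v w :: "3 \<times> Z3_cube"
  obtain s x t y r z where uvw: "u = (s, x)" "v = (t, y)" "w = (r, z)"
    by (metis prod.exhaust)
  show "ext_op u u = u"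
    by (simp add: uvw c_diag core_op_self)
  show "ext_op (ext_op u v) v = u"
    by (simp add: uvw c_core_op core_op_core_op core_op_3(2))
  have "core_op (core_op x y) z = core_op (core_op x z) (core_op y z)"
    by (simp add: core_op_def algebra_simps)
  then show "ext_op (ext_op u v) w = ext_op (ext_op u w) (ext_op v w)"
    using c_cocycle[of x z y] triple_Z3[of r]
    by (simp add: uvw core_op_3(2) eq_diff_eq algebra_simps)
  show "ext_op u v = ext_op v u"
    by (simp add: uvw c_sym[of x y] core_op_3(2) core_op_exponent_3[OF triple_Z3_cube])
qed

text \<open>In exponent 3 the negative of a sum is a product, and negation is the product with 0: a subkei of
  the core through 0 is a subgroup.\<close>

lemma core_closed_add:
  fixes T :: "'a::ab_group_add set"
  assumes exponent: "\<And>z::'a. z + z + z = 0"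
    and closed: "\<And>x y. x \<in> T \<Longrightarrow> y \<in> T \<Longrightarrow> core_op x y \<in> T"
    and "0 \<in> T" "x \<in> T" "y \<in> T"
  shows "x + y \<in> T"
proof -
  have "core_op 0 (core_op x y) = x + y"
    by (simp add: core_op_exponent_3[OF exponent])
  then show ?thesis using closed assms(3-5) by metis
qed

lemma Z3_multiple_in:
  fixes f :: "3 \<Rightarrow> 'a::monoid_add"
  assumes "0 \<in> T" "\<And>x y. x \<in> T \<Longrightarrow> y \<in> T \<Longrightarrow> x + y \<in> T"
    and "f 0 = 0" "f 1 \<in> T" "f 2 = f 1 + f 1"
  shows "f i \<in> T"
proof -
  have "\<forall>i. f i \<in> T" unfolding all_Z3 using assms by auto
  then show ?thesis by blast
qed

lemma Z3_cube_closed_UNIV: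
  assumes closed: "\<And>x y. x \<in> T \<Longrightarrow> y \<in> T \<Longrightarrow> core_op x y \<in> T"
    and T: "(0, 0, 0) \<in> T" "(1, 0, 0) \<in> T" "(0, 1, 0) \<in> T" "(0, 0, 1) \<in> T"
  shows "(x :: Z3_cube) \<in> T"
proof -
  have T0: "0 \<in> T" using T(1) by (simp add: zero_prod_def)
  have add: "u + v \<in> T" if "u \<in> T" "v \<in> T" for u v
    by (rule core_closed_add[OF triple_Z3_cube closed T0 that])
  obtain p q r where x: "x = (p, q, r)" by (rule prod_cases3)
  have "(p, 0, 0) \<in> T"
    by (rule Z3_multiple_in[OF T0 add, where f = "\<lambda>p. (p, 0, 0)"]) (simp_all add: T zero_prod_def)
  moreover have "(0, q, 0) \<in> T"
    by (rule Z3_multiple_in[OF T0 add, where f = "\<lambda>q. (0, q, 0)"]) (simp_all add: T zero_prod_def)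
  moreover have "(0, 0, r) \<in> T"
    by (rule Z3_multiple_in[OF T0 add, where f = "\<lambda>r. (0, 0, r)"]) (simp_all add: T zero_prod_def)
  ultimately have "((p, 0, 0) + (0, q, 0)) + (0, 0, r) \<in> T" by (intro add)
  then show ?thesis by (simp add: x)
qed

text \<open>The span projects onto a subkei of $Z_3^3$ that contains 0 and a basis, hence onto everything. It also
  contains the whole fibre over (1,1,1), because the three products over opposite edges differ there. A
  point \<open>(t, x)\<close> then is the product of any point of the span over \<open>x * (1,1,1)\<close> with a suitable point
  of that fibre.\<close>

lemma generates_ext_op:
  "generates ext_op {(1, 0, 0, 0), (0, 1, 0, 0), (0, 0, 1, 0), (0, 0, 0, 1)}"
proof -
  let ?e = "(1, 0, 0, 0) :: 3 \<times> Z3_cube" and ?a = "(0, 1, 0, 0) :: 3 \<times> Z3_cube"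
    and ?b = "(0, 0, 1, 0) :: 3 \<times> Z3_cube" and ?d = "(0, 0, 0, 1) :: 3 \<times> Z3_cube"
  define T where "T = kei_span ext_op {?e, ?a, ?b, ?d}"
  have gens: "?e \<in> T" "?a \<in> T" "?b \<in> T" "?d \<in> T"
    unfolding T_def by (auto intro: kei_span.base)
  have closed: "ext_op u v \<in> T" if "u \<in> T" "v \<in> T" for u v
    using that unfolding T_def by (rule kei_span.step)
  have base: "x \<in> snd ` T" for x
  proof (rule Z3_cube_closed_UNIV)
    show "core_op u v \<in> snd ` T" if uv: "u \<in> snd ` T" "v \<in> snd ` T" for u v
    proof -
      from uv obtain s t where "(s, u) \<in> T" "(t, v) \<in> T" by force
      then have "ext_op (s, u) (t, v) \<in> T" by (rule closed)
      then show ?thesis by force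
    qed
  qed (use gens in force)+
  let ?v = "(1, 1, 1) :: Z3_cube"
  have mids: "ext_op (ext_op ?a ?b) (ext_op ?e ?d) = (2, ?v)"
    "ext_op (ext_op ?a ?e) (ext_op ?b ?d) = (0, ?v)"
    "ext_op (ext_op ?a ?d) (ext_op ?b ?e) = (1, ?v)"
    by (simp_all add: core_op_Pair core_op_3(2) c_def M_def Z3_nat_def)
  have "(2, ?v) \<in> T" "(0, ?v) \<in> T" "(1, ?v) \<in> T"
    unfolding mids[symmetric] by (intro closed gens)+
  then have "\<forall>t. (t, ?v) \<in> T" unfolding all_Z3 by blast
  then have fibre: "(t, ?v) \<in> T" for t by blast
  have "u \<in> T" for u
  proof -
    obtain t x where u: "u = (t, x)" by (rule prod.exhaust)
    obtain s where s: "(s, core_op x ?v) \<in> T"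
      using base[of "core_op x ?v"] by force
    let ?t' = "c (core_op x ?v) ?v - s - t"
    have "ext_op (s, core_op x ?v) (?t', ?v) = (t, x)"
      by (simp only: ext_op.simps core_op_core_op core_op_3(2)) simp
    then show ?thesis using closed[OF s fibre] u by metis
  qed
  then show ?thesis unfolding generates_def T_def by blast
qed

section \<open>The number of generators of a core\<close>

text \<open>Each further generator enlarges the subgroup spanned by the differences at most by the factor 3.\<close>

lemma differences_in_small_subgroup:
  fixes x0 :: "'a::ab_group_add"
  assumes exponent: "\<And>z::'a. z + z + z = 0" and "finite S"
  shows "\<exists>H. finite H \<and> card H \<le> 3 ^ card S \<and> 0 \<in> H \<and> (\<forall>x \<in> H. \<forall>y \<in> H. x - y \<in> H) \<and>
    (\<forall>s \<in> S. s - x0 \<in> H)"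
  using assms(2)
proof induction
  case empty
  show ?case by (intro exI[of _ "{0}"]) simp
next
  case (insert s S)
  then obtain H where H: "finite H" "card H \<le> 3 ^ card S" "0 \<in> H"
    "\<And>x y. x \<in> H \<Longrightarrow> y \<in> H \<Longrightarrow> x - y \<in> H" "\<And>s. s \<in> S \<Longrightarrow> s - x0 \<in> H"
    by blast
  define t where "t = s - x0"
  have t3: "t + t = - t"
    using exponent[of t] by (simp only: eq_neg_iff_add_eq_0)
  define H' where "H' = (\<lambda>(h, k). h + k) ` (H \<times> {0, t, - t})"
  have "card H' \<le> card (H \<times> {0, t, - t})"
    unfolding H'_def by (rule card_image_le) (use H(1) in simp)
  also have "\<dots> \<le> 3 ^ card S * 3"
    unfolding card_cartesian_product by (rule mult_le_mono[OF H(2)]) (simp add: card_insert_if)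
  finally have "card H' \<le> 3 ^ card (insert s S)"
    using insert.hyps by simp
  moreover have "finite H'" unfolding H'_def using H(1) by simp
  moreover have in_H': "h + k \<in> H'" if "h \<in> H" "k \<in> {0, t, - t}" for h k
    unfolding H'_def using that by force
  moreover have "0 \<in> H'" using in_H'[of 0 0] H(3) by simp
  moreover have "x - y \<in> H'" if "x \<in> H'" "y \<in> H'" for x y
  proof -
    from that obtain h k h' k' where
      x: "x = h + k" "h \<in> H" "k \<in> {0, t, - t}" and y: "y = h' + k'" "h' \<in> H" "k' \<in> {0, t, - t}"
      unfolding H'_def by auto
    have "t - - t = - t"
      by (simp add: t3)
    moreover have "- t - t = t"
      using arg_cong[OF t3, of uminus] by simp
    ultimately have "k - k' \<in> {0, t, - t}"
      using x(3) y(3) by auto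
    then have "(h - h') + (k - k') \<in> H'"
      using H(4) x(2) y(2) by (intro in_H')
    then show ?thesis by (simp add: x(1) y(1) algebra_simps)
  qed
  moreover have "r - x0 \<in> H'" if "r \<in> insert s S" for r
    using that in_H'[of "r - x0" 0] in_H'[of 0 t] H(3,5) by (auto simp: t_def)
  ultimately show ?case by blast
qed

text \<open>The span of a nonempty set lies in a coset of the subgroup generated by the differences of its
  points.\<close>

lemma card_le_power_generators:
  fixes S :: "'a::ab_group_add set"
  assumes exponent: "\<And>z::'a. z + z + z = 0"
    and S: "finite S" "generates core_op S"
  shows "card (UNIV :: 'a set) \<le> 3 ^ (card S - 1)"
proof -
  have "S \<noteq> {}"
  proof
    assume "S = {}"
    have "x \<notin> kei_span core_op {}" for x :: 'a
    proof
      assume "x \<in> kei_span core_op {}"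
      then show False by induction auto
    qed
    then show False using S(2) \<open>S = {}\<close> by (auto simp: generates_def)
  qed
  then obtain x0 where x0: "x0 \<in> S" by blast
  obtain H where H: "finite H" "card H \<le> 3 ^ card (S - {x0})" "0 \<in> H"
    "\<And>x y. x \<in> H \<Longrightarrow> y \<in> H \<Longrightarrow> x - y \<in> H" "\<And>s. s \<in> S - {x0} \<Longrightarrow> s - x0 \<in> H"
    using differences_in_small_subgroup[OF exponent, of "S - {x0}" x0] S(1) by (metis finite_Diff)
  have "x - x0 \<in> H" if "x \<in> kei_span core_op S" for x
    using that
  proof induction
    case (base s)
    then show ?case using H(3,5) by (cases "s = x0") auto
  next
    case (step x y)
    have "core_op x y - x0 = (y - x0) - ((x - x0) - (y - x0))"
      by (simp add: core_op_def algebra_simps)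
    moreover have "(y - x0) - ((x - x0) - (y - x0)) \<in> H"
      by (rule H(4)[OF step.IH(2) H(4)[OF step.IH(1) step.IH(2)]])
    ultimately show ?case by (simp only:)
  qed
  then have "x \<in> (+) x0 ` H" for x
    using S(2) unfolding generates_def by (intro image_eqI[of _ _ "x - x0"]) auto
  then have "UNIV = (+) x0 ` H" by blast
  then have "card (UNIV :: 'a set) \<le> card H"
    using card_image_le[OF H(1)] by metis
  then show ?thesis using H(2) x0 S(1) by simp
qed

lemma min_generator_number_core_Z3_4:
  "min_generator_number (core_op :: 3 \<times> 3 \<times> 3 \<times> 3 \<Rightarrow> _) 5"
  unfolding min_generator_number_def
proof (intro conjI allI impI)
  let ?S = "{(0, 0, 0, 0), (1, 0, 0, 0), (0, 1, 0, 0), (0, 0, 1, 0), (0, 0, 0, 1)} :: (3 \<times> 3 \<times> 3 \<times> 3) set"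
  define T where "T = kei_span core_op ?S"
  have gens: "s \<in> T" if "s \<in> ?S" for s
    using that unfolding T_def by (rule kei_span.base)
  have T0: "0 \<in> T" using gens[of "(0, 0, 0, 0)"] by (simp add: zero_prod_def)
  have add: "u + v \<in> T" if "u \<in> T" "v \<in> T" for u v
    by (rule core_closed_add[OF triple_Z3_4 _ T0 that]) (unfold T_def, rule kei_span.step)
  have "x \<in> T" for x
  proof -
    obtain p q r s where x: "x = (p, q, r, s)" by (rule prod_cases4)
    have "(p, 0, 0, 0) \<in> T"
      by (rule Z3_multiple_in[OF T0 add, where f = "\<lambda>p. (p, 0, 0, 0)"]) (simp_all add: gens zero_prod_def)
    moreover have "(0, q, 0, 0) \<in> T"
      by (rule Z3_multiple_in[OF T0 add, where f = "\<lambda>q. (0, q, 0, 0)"]) (simp_all add: gens zero_prod_def)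
    moreover have "(0, 0, r, 0) \<in> T"
      by (rule Z3_multiple_in[OF T0 add, where f = "\<lambda>r. (0, 0, r, 0)"]) (simp_all add: gens zero_prod_def)
    moreover have "(0, 0, 0, s) \<in> T"
      by (rule Z3_multiple_in[OF T0 add, where f = "\<lambda>s. (0, 0, 0, s)"]) (simp_all add: gens zero_prod_def)
    ultimately have "(((p, 0, 0, 0) + (0, q, 0, 0)) + (0, 0, r, 0)) + (0, 0, 0, s) \<in> T"
      by (intro add)
    then show ?thesis by (simp add: x)
  qed
  then have "generates core_op ?S" unfolding generates_def T_def by blast
  then show "\<exists>S :: (3 \<times> 3 \<times> 3 \<times> 3) set. finite S \<and> card S = 5 \<and> generates core_op S"
    by (intro exI[of _ ?S]) simp
next
  fix S :: "(3 \<times> 3 \<times> 3 \<times> 3) set"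
  assume S: "finite S \<and> generates core_op S"
  then have "card (UNIV :: (3 \<times> 3 \<times> 3 \<times> 3) set) \<le> 3 ^ (card S - 1)"
    using card_le_power_generators[OF triple_Z3_4] by blast
  then have "(3::nat) ^ 4 \<le> 3 ^ (card S - 1)"
    by (simp add: card_prod)
  then have "4 \<le> card S - 1"
    by (subst (asm) power_increasing_iff) simp_all
  then show "5 \<le> card S" by simp
qed

lemma kei_span_hom_image:
  assumes "\<And>x y. f (op x y) = op' (f x) (f y)"
  shows "kei_span op' (f ` S) = f ` kei_span op S"
proof
  show "kei_span op' (f ` S) \<subseteq> f ` kei_span op S"
  proof
    fix y assume "y \<in> kei_span op' (f ` S)"
    then show "y \<in> f ` kei_span op S"
    proof induction
      case (step x y)
      then obtain u v where "u \<in> kei_span op S" "v \<in> kei_span op S" "x = f u" "y = f v" by blast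
      then show ?case by (metis assms image_eqI kei_span.step)
    qed (auto intro: kei_span.base)
  qed
  have "f x \<in> kei_span op' (f ` S)" if "x \<in> kei_span op S" for x
    using that by induction (auto simp: assms intro: kei_span.intros)
  then show "f ` kei_span op S \<subseteq> kei_span op' (f ` S)" by blast
qed

lemma ext_op_not_isomorphic_core:
  "\<not> kei_isomorphic ext_op (core_op :: 3 \<times> 3 \<times> 3 \<times> 3 \<Rightarrow> _)"
proof
  assume "kei_isomorphic ext_op (core_op :: 3 \<times> 3 \<times> 3 \<times> 3 \<Rightarrow> _)"
  then obtain f :: "3 \<times> Z3_cube \<Rightarrow> 3 \<times> 3 \<times> 3 \<times> 3"
    where f: "bij f" "\<And>x y. f (ext_op x y) = core_op (f x) (f y)"
    unfolding kei_isomorphic_def by blast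
  let ?S = "{(1, 0, 0, 0), (0, 1, 0, 0), (0, 0, 1, 0), (0, 0, 0, 1)} :: (3 \<times> Z3_cube) set"
  have "kei_span core_op (f ` ?S) = f ` kei_span ext_op ?S"
    by (rule kei_span_hom_image) (rule f(2))
  also have "\<dots> = f ` UNIV"
    using generates_ext_op by (simp only: generates_def)
  also have "\<dots> = UNIV"
    using f(1) by (rule bij_is_surj)
  finally have "generates core_op (f ` ?S)"
    unfolding generates_def .
  then have "5 \<le> card (f ` ?S)"
    using min_generator_number_core_Z3_4 unfolding min_generator_number_def by simp
  also have "\<dots> \<le> card ?S" by (rule card_image_le) simp
  also have "\<dots> = 4" by simp
  finally show False by simp
qed

section \<open>The free commutative kei\<close>

primrec term_value :: "('a \<Rightarrow> 'a \<Rightarrow> 'a) \<Rightarrow> ('g \<Rightarrow> 'a) \<Rightarrow> 'g kei_term \<Rightarrow> 'a" where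
  "term_value op v (Gen g) = v g"
| "term_value op v (Prod s t) = op (term_value op v s) (term_value op v t)"

lemma (in commutative_kei) term_value_cong:
  "burnside3_cong s t \<Longrightarrow> term_value (\<star>) v s = term_value (\<star>) v t"
proof (induction rule: burnside3_cong.induct)
  case distrib': (distrib x y z)
  show ?case unfolding term_value.simps by (rule distrib)
qed (simp_all add: idem)

lemma abs_burnside3_surj: "\<exists>t. x = abs_burnside3 t"
  by (induct x rule: burnside3.abs_induct) blast

text \<open>The universal property of the free kei.\<close>

lemma (in commutative_kei) burnside3_hom_exists:
  obtains h where "\<And>x y. h (burnside3_op x y) = h x \<star> h y"
    "\<And>g. h (abs_burnside3 (Gen g)) = v g"
proof -
  define h where "h x = term_value (\<star>) v (rep_burnside3 x)" for x
  have h_abs: "h (abs_burnside3 t) = term_value (\<star>) v t" for t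
    unfolding h_def by (rule term_value_cong) (rule Quotient3_rep_abs[OF Quotient3_burnside3 burnside3_cong.refl])
  have gen: "h (abs_burnside3 (Gen g)) = v g" for g
    by (simp add: h_abs)
  have hom: "h (burnside3_op x y) = h x \<star> h y" for x y
  proof -
    obtain s t where "x = abs_burnside3 s" "y = abs_burnside3 t"
      using abs_burnside3_surj by blast
    then show ?thesis by (simp add: burnside3_op.abs_eq h_abs)
  qed
  show thesis using hom gen by (rule that)
qed

lemma commutative_kei_burnside3_op: "commutative_kei burnside3_op"
proof
  fix x y z :: "'g burnside3"
  show "burnside3_op x x = x"
    by transfer (rule burnside3_cong.idem)
  show invol: "burnside3_op (burnside3_op x y) y = x" for x y :: "'g burnside3"
    by transfer (rule burnside3_cong.invol)
  show "burnside3_op (burnside3_op x y) z = burnside3_op (burnside3_op x z) (burnside3_op y z)"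
    by transfer (rule burnside3_cong.distrib)
  have "x = burnside3_op (burnside3_op y x) y"
    by transfer (rule burnside3_cong.burnside)
  then have "burnside3_op x y = burnside3_op (burnside3_op (burnside3_op y x) y) y"
    by (rule arg_cong)
  then show "burnside3_op x y = burnside3_op y x"
    by (simp only: invol)
qed

lemma burnside3_generated: "kei_span burnside3_op (range (\<lambda>g. abs_burnside3 (Gen g))) = UNIV"
proof -
  have "abs_burnside3 t \<in> kei_span burnside3_op (range (\<lambda>g. abs_burnside3 (Gen g)))" for t :: "'g kei_term"
  proof (induction t)
    case (Prod s t)
    then show ?case
      by (simp flip: burnside3_op.abs_eq) (rule kei_span.step)
  qed (auto intro: kei_span.base)
  then show ?thesis using abs_burnside3_surj by (metis UNIV_eq_I)
qed

text \<open>The homomorphism that extends the choice of generators is onto, since its image generates. The free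
  kei has four generators and therefore no more elements than the extension.\<close>

lemma burnside3_isomorphic_ext_op: "kei_isomorphic (burnside3_op :: 4 burnside3 \<Rightarrow> _) ext_op"
proof -
  interpret E: commutative_kei ext_op by (rule commutative_kei_ext_op)
  let ?g = "\<lambda>i :: 4. abs_burnside3 (Gen i)"
  define v :: "4 \<Rightarrow> 3 \<times> Z3_cube" where
    "v i = (if i = 0 then (1, 0, 0, 0) else if i = 1 then (0, 1, 0, 0)
      else if i = 2 then (0, 0, 1, 0) else (0, 0, 0, 1))" for i
  have UNIV_4: "{0, 1, 2, 3 :: 4} = UNIV"
    by (rule card_subset_eq) simp_all
  have range_g: "range ?g = {?g 0, ?g 1, ?g 2, ?g 3}"
    by (simp only: UNIV_4[symmetric] image_insert image_empty)
  interpret four_generated "burnside3_op :: 4 burnside3 \<Rightarrow> _" "?g 0" "?g 1" "?g 2" "?g 3"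
    unfolding four_generated_def four_generated_axioms_def range_g[symmetric]
    by (intro conjI commutative_kei_burnside3_op burnside3_generated)
  obtain h where hom: "\<And>x y. h (burnside3_op x y) = ext_op (h x) (h y)"
    and gens: "\<And>i. h (?g i) = v i"
    using E.burnside3_hom_exists[of v] by metis
  have "range h = h ` kei_span burnside3_op (range ?g)"
    by (simp only: burnside3_generated)
  also have "\<dots> = kei_span ext_op (h ` range ?g)"
    by (rule kei_span_hom_image[symmetric]) (rule hom)
  also have "h ` range ?g = {(1, 0, 0, 0), (0, 1, 0, 0), (0, 0, 1, 0), (0, 0, 0, 1)}"
    unfolding range_g image_insert image_empty gens by (simp add: v_def)
  also have "kei_span ext_op \<dots> = UNIV"
    using generates_ext_op by (simp only: generates_def)
  finally have surj: "range h = UNIV" .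
  have "card (UNIV :: (3 \<times> Z3_cube) set) = 81"
    by (simp add: card_prod)
  then have "card (range h) = card (UNIV :: 4 burnside3 set)"
    using card_le_81 card_image_le[of UNIV h] by (simp add: surj)
  then have "inj h"
    using card_le_81(1) by (rule eq_card_imp_inj_on[rotated])
  then show ?thesis
    unfolding kei_isomorphic_def using surj hom by (auto simp: bij_def)
qed

theorem mainTheorem4:
  shows
    "(\<forall>x. c x x = 0) \<and>
     (\<forall>x y. c (core_op x y) y = c x y) \<and>
     (\<forall>x1 x2 x3.
        c (core_op x1 x3) (core_op x2 x3) - c (core_op x1 x2) x3
          = - c x1 x2 + c x2 x3 + c x1 x3) \<and>
     (\<forall>x y. c x y = c y x) \<and>
     kei ext_op \<and>
     (\<forall>a b. a = ext_op (ext_op b a) b) \<and>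
     commutative_kei ext_op \<and>
     card (UNIV :: (3 \<times> Z3_cube) set) = 81 \<and>
     generates ext_op {(1, 0, 0, 0), (0, 1, 0, 0), (0, 0, 1, 0), (0, 0, 0, 1)} \<and>
     min_generator_number (core_op :: 3 \<times> 3 \<times> 3 \<times> 3 \<Rightarrow> _) 5 \<and>
     \<not> kei_isomorphic ext_op (core_op :: 3 \<times> 3 \<times> 3 \<times> 3 \<Rightarrow> _) \<and>
     kei_isomorphic (burnside3_op :: 4 burnside3 \<Rightarrow> _) ext_op"
proof (intro conjI allI)
  interpret commutative_kei ext_op by (rule commutative_kei_ext_op)
  show "kei ext_op" by unfold_locales
  show "commutative_kei ext_op" by (rule commutative_kei_ext_op)
  show "u = ext_op (ext_op v u) v" for u v by (rule cancel(2)[symmetric])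
  show "card (UNIV :: (3 \<times> Z3_cube) set) = 81" by (simp add: card_prod)
qed (rule c_diag c_core_op c_cocycle c_sym generates_ext_op min_generator_number_core_Z3_4
    ext_op_not_isomorphic_core burnside3_isomorphic_ext_op)+

end
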